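(* Let $(A,\mu)\in\mathcal C$ and let $\mathfrak N:A\to A$ be a Nijenhuis operator. Define a new product $\star$ on $A$ by setting $a\star a':=\mathfrak N(a)a'+a\mathfrak N(a')-\mathfrak N(aa')$ for all $a,a'\in A$. Then $(A,\star)\in\mathcal C$.
   Context: Fix a commutative ring $R$; all modules, tensor products and linear maps are over $R$. An algebra $(A,\mu)$ is an $R$-module $A$ with a linear map (product) $\mu:A\otimes A\to A$; no associativity or unit is assumed. Write $ab=\mu(a\otimes b)$. Fix a collection of multilinear relations $\mathcal R_1=0,\dots,\mathcal R_k=0$ in one binary product: an $n$-linear relation is an $R$-linear combination of parenthesized (non-associative) monomials in $x_1,\dots,x_n$, each variable occurring exactly once in each monomial. $\mathcal C$ is the category of all algebras $(A,\mu)$ in which these relations hold for all substitutions of elements of $A$; $(A,\mu)\in\mathcal C$ means that $(A,\mu)$ satisfies all of them. Nijenhuis operator for $(A,\mu)\in\mathcal C$: a linear map $\mathfrak N:A\to A$ such that $\mathfrak N(a)\mathfrak N(a')=\mathfrak N\big(\mathfrak N(a)a'+a\mathfrak N(a')-\mathfrak N(aa')\big)$ for all $a,a'\in A$. *)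

theory Defs
  imports "HOL-Algebra.Module"
begin

definition linear_map ::
  "('r, 'm) ring_scheme \<Rightarrow> ('r, 'a, 'p) module_scheme \<Rightarrow> ('r, 'b, 'q) module_scheme \<Rightarrow> ('a \<Rightarrow> 'b) \<Rightarrow> bool"
  where "linear_map R A B f \<longleftrightarrow>
    f \<in> carrier A \<rightarrow> carrier B \<and>
    (\<forall>x\<in>carrier A. \<forall>y\<in>carrier A. f (x \<oplus>\<^bsub>A\<^esub> y) = f x \<oplus>\<^bsub>B\<^esub> f y) \<and>
    (\<forall>c\<in>carrier R. \<forall>x\<in>carrier A. f (c \<odot>\<^bsub>A\<^esub> x) = c \<odot>\<^bsub>B\<^esub> f x)"

text \<open>
  A linear map from the tensor square of \<open>A\<close> to \<open>A\<close> is given as a bilinear map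
  \<open>\<mu>\<close>, where \<open>\<mu> a b\<close> is the value at the pure tensor of \<open>a\<close> and \<open>b\<close>.
  The multiplication and unit fields that a record of type \<open>module\<close> inherits from
  \<open>ring\<close> are not constrained by the locale \<open>module\<close> and play no role here: the
  product of the algebra is always the separate argument \<open>\<mu>\<close>.
\<close>

definition nonassoc_algebra ::
  "('r, 'm) ring_scheme \<Rightarrow> ('r, 'a, 'p) module_scheme \<Rightarrow> ('a \<Rightarrow> 'a \<Rightarrow> 'a) \<Rightarrow> bool"
  where "nonassoc_algebra R A \<mu> \<longleftrightarrow>
    module R A \<and>
    (\<forall>a\<in>carrier A. linear_map R A A (\<lambda>b. \<mu> a b)) \<and>
    (\<forall>b\<in>carrier A. linear_map R A A (\<lambda>a. \<mu> a b))"

text \<open>\<open>Var i\<close> stands for the variable with index \<open>i\<close>, counted from 1.\<close>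

datatype monomial = Var nat | Mul monomial monomial

primrec leaves :: "monomial \<Rightarrow> nat list" where
  "leaves (Var i) = [i]"
| "leaves (Mul s t) = leaves s @ leaves t"

definition multilinear_monomial :: "nat \<Rightarrow> monomial \<Rightarrow> bool" where
  "multilinear_monomial n t \<longleftrightarrow> distinct (leaves t) \<and> set (leaves t) = {1..n}"

text \<open>A formal linear combination of monomials is a list of (coefficient, monomial) pairs.\<close>

definition multilinear_relation ::
  "('r, 'm) ring_scheme \<Rightarrow> nat \<Rightarrow> ('r \<times> monomial) list \<Rightarrow> bool"
  where "multilinear_relation R n r \<longleftrightarrow>
    (\<forall>(c, t)\<in>set r. c \<in> carrier R \<and> multilinear_monomial n t)"

primrec eval_monomial :: "('a \<Rightarrow> 'a \<Rightarrow> 'a) \<Rightarrow> (nat \<Rightarrow> 'a) \<Rightarrow> monomial \<Rightarrow> 'a" where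
  "eval_monomial \<mu> x (Var i) = x i"
| "eval_monomial \<mu> x (Mul s t) = \<mu> (eval_monomial \<mu> x s) (eval_monomial \<mu> x t)"

definition eval_relation ::
  "('r, 'a, 'p) module_scheme \<Rightarrow> ('a \<Rightarrow> 'a \<Rightarrow> 'a) \<Rightarrow> (nat \<Rightarrow> 'a) \<Rightarrow> ('r \<times> monomial) list \<Rightarrow> 'a"
  where "eval_relation A \<mu> x r =
    foldr (\<lambda>(c, t) s. c \<odot>\<^bsub>A\<^esub> eval_monomial \<mu> x t \<oplus>\<^bsub>A\<^esub> s) r \<zero>\<^bsub>A\<^esub>"

text \<open>\<open>in_category R rels A \<mu>\<close> says that \<open>(A, \<mu>)\<close> is an object of the category of
  algebras over \<open>R\<close> in which all relations of the list \<open>rels\<close> hold.\<close>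

definition in_category ::
  "('r, 'm) ring_scheme \<Rightarrow> ('r \<times> monomial) list list \<Rightarrow>
   ('r, 'a, 'p) module_scheme \<Rightarrow> ('a \<Rightarrow> 'a \<Rightarrow> 'a) \<Rightarrow> bool"
  where "in_category R rels A \<mu> \<longleftrightarrow>
    nonassoc_algebra R A \<mu> \<and>
    (\<forall>r\<in>set rels. \<forall>x\<in>UNIV \<rightarrow> carrier A. eval_relation A \<mu> x r = \<zero>\<^bsub>A\<^esub>)"

definition nijenhuis_product ::
  "('r, 'a, 'p) module_scheme \<Rightarrow> ('a \<Rightarrow> 'a \<Rightarrow> 'a) \<Rightarrow> ('a \<Rightarrow> 'a) \<Rightarrow> 'a \<Rightarrow> 'a \<Rightarrow> 'a"
  where "nijenhuis_product A \<mu> N a a' =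
    (\<mu> (N a) a' \<oplus>\<^bsub>A\<^esub> \<mu> a (N a')) \<ominus>\<^bsub>A\<^esub> N (\<mu> a a')"

definition nijenhuis_operator ::
  "('r, 'm) ring_scheme \<Rightarrow> ('r, 'a, 'p) module_scheme \<Rightarrow> ('a \<Rightarrow> 'a \<Rightarrow> 'a) \<Rightarrow> ('a \<Rightarrow> 'a) \<Rightarrow> bool"
  where "nijenhuis_operator R A \<mu> N \<longleftrightarrow>
    linear_map R A A N \<and>
    (\<forall>a\<in>carrier A. \<forall>a'\<in>carrier A.
      \<mu> (N a) (N a') = N ((\<mu> (N a) a' \<oplus>\<^bsub>A\<^esub> \<mu> a (N a')) \<ominus>\<^bsub>A\<^esub> N (\<mu> a a')))"

end

theory Submission
  imports Defs "HOL-Algebra.AbelCoset"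
begin

text \<open>Over the formal power series \<open>A[[X]]\<close>, the Nijenhuis identity says exactly that
  \<open>T = id + X N\<close> is a homomorphism from the deformed product \<open>\<mu> + X \<star>\<close> to \<open>\<mu>\<close>.
  A multilinear relation that holds in \<open>A\<close> holds in \<open>A[[X]]\<close> with the product \<open>\<mu>\<close>, hence
  for the deformed product, because \<open>T\<close> is injective. On constant series a monomial
  of degree \<open>n\<close> in the deformed product is a polynomial in \<open>X\<close> whose coefficient at
  \<open>X^(n - 1)\<close> is the same monomial in the product \<open>\<star>\<close>, so comparing these coefficients
  gives the relation for \<open>\<star>\<close>.\<close>

section \<open>Linear maps and algebras\<close>

lemma linear_mapD:
  assumes "linear_map R A B f"
  shows "x \<in> carrier A \<Longrightarrow> f x \<in> carrier B"
    and "\<lbrakk>x \<in> carrier A; y \<in> carrier A\<rbrakk> \<Longrightarrow> f (x \<oplus>\<^bsub>A\<^esub> y) = f x \<oplus>\<^bsub>B\<^esub> f y"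
    and "\<lbrakk>c \<in> carrier R; x \<in> carrier A\<rbrakk> \<Longrightarrow> f (c \<odot>\<^bsub>A\<^esub> x) = c \<odot>\<^bsub>B\<^esub> f x"
  using assms by (auto simp: linear_map_def)

lemma linear_map_abelian_group_hom:
  assumes "module R A" "module R B" "linear_map R A B f"
  shows "abelian_group_hom A B f"
proof -
  interpret A: module R A by fact
  interpret B: module R B by fact
  show ?thesis
    using linear_mapD[OF assms(3)]
    by (intro abelian_group_homI group_hom.intro group_hom_axioms.intro
        A.abelian_group_axioms B.abelian_group_axioms A.a_group B.a_group)
       (auto simp: hom_def)
qed

lemma linear_map_zero:
  assumes "module R A" "module R B" "linear_map R A B f"
  shows "f \<zero>\<^bsub>A\<^esub> = \<zero>\<^bsub>B\<^esub>"
  using abelian_group_hom.hom_zero[OF linear_map_abelian_group_hom[OF assms]] .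

lemma linear_map_a_inv:
  assumes "module R A" "module R B" "linear_map R A B f" "x \<in> carrier A"
  shows "f (\<ominus>\<^bsub>A\<^esub> x) = \<ominus>\<^bsub>B\<^esub> f x"
  using abelian_group_hom.hom_a_inv[OF linear_map_abelian_group_hom[OF assms(1-3)]] assms(4) .

section \<open>Evaluation of monomials and relations\<close>

lemma eval_monomial_cong:
  "(\<And>i. i \<in> set (leaves t) \<Longrightarrow> x i = y i) \<Longrightarrow> eval_monomial \<mu> x t = eval_monomial \<mu> y t"
  by (induction t) auto

text \<open>Assignments are total on \<open>nat\<close>, but the leaves of a multilinear relation
  are exactly the indices 1 to n; values elsewhere can be chosen freely.\<close>

lemma eval_relation_cong:
  assumes "multilinear_relation R n r" "\<And>i. i \<in> {1..n} \<Longrightarrow> x i = y i"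
  shows "eval_relation A \<mu> x r = eval_relation A \<mu> y r"
proof -
  have "eval_monomial \<mu> x t = eval_monomial \<mu> y t" if "(c, t) \<in> set r" for c t
    using assms that
    by (intro eval_monomial_cong) (auto simp: multilinear_relation_def multilinear_monomial_def)
  then show ?thesis
    unfolding eval_relation_def by (intro foldr_cong) auto
qed

text \<open>The product is a locale parameter because these results are instantiated for several
  products: \<open>\<mu>\<close> and \<open>star\<close> on \<open>A\<close>, their Cauchy products,
  and the deformed product on series.\<close>

locale nonassoc_alg = module R A
  for R :: "('r, 'm) ring_scheme" and A :: "('r, 'a, 'p) module_scheme" +
  fixes \<mu> :: "'a \<Rightarrow> 'a \<Rightarrow> 'a"
  assumes nonassoc_algebra: "nonassoc_algebra R A \<mu>"

lemma nonassoc_alg_iff: "nonassoc_alg R A \<mu> \<longleftrightarrow> nonassoc_algebra R A \<mu>"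
  by (auto simp: nonassoc_alg_def nonassoc_alg_axioms_def nonassoc_algebra_def)

context nonassoc_alg
begin

lemma linear_map_mult:
  shows "a \<in> carrier A \<Longrightarrow> linear_map R A A (\<lambda>b. \<mu> a b)"
    and "b \<in> carrier A \<Longrightarrow> linear_map R A A (\<lambda>a. \<mu> a b)"
  using nonassoc_algebra by (auto simp: nonassoc_algebra_def)

lemma mult_closed [simp, intro]:
  "\<lbrakk>a \<in> carrier A; b \<in> carrier A\<rbrakk> \<Longrightarrow> \<mu> a b \<in> carrier A"
  using linear_mapD(1)[OF linear_map_mult(1)] .

lemma mult_add:
  assumes "a \<in> carrier A" "b \<in> carrier A" "c \<in> carrier A"
  shows "\<mu> a (b \<oplus>\<^bsub>A\<^esub> c) = \<mu> a b \<oplus>\<^bsub>A\<^esub> \<mu> a c"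
    and "\<mu> (a \<oplus>\<^bsub>A\<^esub> b) c = \<mu> a c \<oplus>\<^bsub>A\<^esub> \<mu> b c"
  using linear_mapD(2)[OF linear_map_mult(1)] linear_mapD(2)[OF linear_map_mult(2)] assms
  by auto

lemma mult_smult:
  assumes "c \<in> carrier R" "a \<in> carrier A" "b \<in> carrier A"
  shows "\<mu> a (c \<odot>\<^bsub>A\<^esub> b) = c \<odot>\<^bsub>A\<^esub> \<mu> a b"
    and "\<mu> (c \<odot>\<^bsub>A\<^esub> a) b = c \<odot>\<^bsub>A\<^esub> \<mu> a b"
  using linear_mapD(3)[OF linear_map_mult(1)] linear_mapD(3)[OF linear_map_mult(2)] assms
  by auto

lemma mult_zero [simp]:
  assumes "a \<in> carrier A"
  shows "\<mu> a \<zero>\<^bsub>A\<^esub> = \<zero>\<^bsub>A\<^esub>" and "\<mu> \<zero>\<^bsub>A\<^esub> a = \<zero>\<^bsub>A\<^esub>"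
  using linear_map_zero[OF module_axioms module_axioms] linear_map_mult assms by fastforce+

lemma eval_monomial_closed:
  assumes "\<And>i. x i \<in> carrier A"
  shows "eval_monomial \<mu> x t \<in> carrier A"
  using assms by (induction t) auto

lemma eval_relation_simps:
  "eval_relation A \<mu> x ((c, t) # r) =
    c \<odot>\<^bsub>A\<^esub> eval_monomial \<mu> x t \<oplus>\<^bsub>A\<^esub> eval_relation A \<mu> x r"
  "eval_relation A \<mu> x [] = \<zero>\<^bsub>A\<^esub>"
  by (simp_all add: eval_relation_def)

lemma eval_relation_closed:
  assumes "\<And>i. x i \<in> carrier A" "fst ` set r \<subseteq> carrier R"
  shows "eval_relation A \<mu> x r \<in> carrier A"
  using assms(2)
  by (induction r) (auto simp: eval_relation_simps eval_monomial_closed[OF assms(1)])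

section \<open>Additivity in each variable\<close>

lemma eval_monomial_fresh:
  "i \<notin> set (leaves t) \<Longrightarrow> eval_monomial \<nu> (x(i := a)) t = eval_monomial \<nu> x t"
  by (intro eval_monomial_cong) auto

text \<open>Distinct leaves put variable i into exactly one factor of a product. The other factor
  does not see the update, so bilinearity carries the sum outwards.\<close>

lemma eval_monomial_add:
  assumes "\<And>j. x j \<in> carrier A" "a \<in> carrier A" "b \<in> carrier A"
    and "distinct (leaves t)" "i \<in> set (leaves t)"
  shows "eval_monomial \<mu> (x(i := a \<oplus>\<^bsub>A\<^esub> b)) t =
    eval_monomial \<mu> (x(i := a)) t \<oplus>\<^bsub>A\<^esub> eval_monomial \<mu> (x(i := b)) t"
  using assms(4,5)
proof (induction t)
  case (Mul s t)
  have [simp]: "eval_monomial \<mu> x u \<in> carrier A"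
    "eval_monomial \<mu> (x(i := a)) u \<in> carrier A"
    "eval_monomial \<mu> (x(i := b)) u \<in> carrier A" for u
    using assms(1-3) by (auto intro!: eval_monomial_closed)
  show ?case
  proof (cases "i \<in> set (leaves s)")
    case True
    then have "i \<notin> set (leaves t)" using Mul.prems by auto
    with True Mul show ?thesis by (simp add: eval_monomial_fresh mult_add del: fun_upd_apply)
  next
    case False
    with Mul show ?thesis by (simp add: eval_monomial_fresh mult_add del: fun_upd_apply)
  qed
qed auto

lemma eval_relation_add:
  assumes "\<And>j. x j \<in> carrier A" "a \<in> carrier A" "b \<in> carrier A"
    and "multilinear_relation R n r" "i \<in> {1..n}"
  shows "eval_relation A \<mu> (x(i := a \<oplus>\<^bsub>A\<^esub> b)) r =
    eval_relation A \<mu> (x(i := a)) r \<oplus>\<^bsub>A\<^esub> eval_relation A \<mu> (x(i := b)) r"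
  using assms(4)
proof (induction r)
  case (Cons ct r)
  obtain c t where ct: "ct = (c, t)" by (cases ct)
  have c: "c \<in> carrier R" and t: "distinct (leaves t)" "i \<in> set (leaves t)"
    and r: "multilinear_relation R n r"
    using Cons.prems assms(5) by (auto simp: multilinear_relation_def multilinear_monomial_def ct)
  have r': "fst ` set r \<subseteq> carrier R" using r by (auto simp: multilinear_relation_def)
  have 1: "eval_monomial \<mu> (x(i := a)) t \<in> carrier A" "eval_monomial \<mu> (x(i := b)) t \<in> carrier A"
    "eval_relation A \<mu> (x(i := a)) r \<in> carrier A" "eval_relation A \<mu> (x(i := b)) r \<in> carrier A"
    using assms(1-3) r' by (auto intro!: eval_monomial_closed eval_relation_closed)
  show ?case
    using c 1 Cons.IH[OF r]
    by (simp add: ct eval_relation_simps eval_monomial_add[OF assms(1-3) t] smult_r_distr M.a_ac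
        del: fun_upd_apply)
qed (simp add: eval_relation_simps)

section \<open>Compatibility of evaluation with homomorphisms\<close>

lemma hom_eval_monomial:
  assumes "\<And>a b. \<lbrakk>a \<in> carrier A; b \<in> carrier A\<rbrakk> \<Longrightarrow> f (\<mu> a b) = \<nu> (f a) (f b)"
    and "\<And>i. x i \<in> carrier A"
  shows "f (eval_monomial \<mu> x t) = eval_monomial \<nu> (f \<circ> x) t"
  by (induction t) (auto simp: assms eval_monomial_closed)

text \<open>Meant for \<open>trivialization\<close>, which leads from the deformed product to the
  Cauchy product. Multiplicativity handles each monomial, linearity their combination.\<close>

lemma hom_eval_relation:
  assumes "nonassoc_alg R B \<nu>" "linear_map R A B f"
    and "\<And>a b. \<lbrakk>a \<in> carrier A; b \<in> carrier A\<rbrakk> \<Longrightarrow> f (\<mu> a b) = \<nu> (f a) (f b)"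
    and "\<And>i. x i \<in> carrier A" "fst ` set r \<subseteq> carrier R"
  shows "f (eval_relation A \<mu> x r) = eval_relation B \<nu> (f \<circ> x) r"
proof -
  interpret B: nonassoc_alg R B \<nu> by fact
  show ?thesis using assms(5)
  proof (induction r)
    case Nil
    show ?case
      using linear_map_zero[OF module_axioms B.module_axioms assms(2)]
      by (simp add: eval_relation_simps B.eval_relation_simps)
  next
    case (Cons ct r)
    then show ?case
      by (cases ct)
         (auto simp: eval_relation_simps B.eval_relation_simps linear_mapD[OF assms(2)]
           hom_eval_monomial[of f \<nu>, OF assms(3,4)] eval_relation_closed[OF assms(4)]
           eval_monomial_closed[OF assms(4)] simp del: o_apply)
  qed
qed

end

section \<open>Formal power series with coefficients in an algebra\<close>

text \<open>A series is its coefficient function. The record type also asks for the ring operations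
  \<open>mult\<close> and \<open>one\<close>; both get zero as default value.\<close>

definition series_module ::
  "('r, 'a, 'p) module_scheme \<Rightarrow> ('r, nat \<Rightarrow> 'a) module" where
  "series_module A = \<lparr>carrier = UNIV \<rightarrow> carrier A, mult = \<lambda>p q k. \<zero>\<^bsub>A\<^esub>, one = \<lambda>k. \<zero>\<^bsub>A\<^esub>,
     zero = \<lambda>k. \<zero>\<^bsub>A\<^esub>, add = \<lambda>p q k. p k \<oplus>\<^bsub>A\<^esub> q k, smult = \<lambda>c p k. c \<odot>\<^bsub>A\<^esub> p k\<rparr>"

text \<open>The Cauchy product: the extension of \<open>\<mu>\<close> to \<open>A[[X]]\<close> that
  treats X as a scalar.\<close>

definition series_mult ::
  "('r, 'a, 'p) module_scheme \<Rightarrow> ('a \<Rightarrow> 'a \<Rightarrow> 'a) \<Rightarrow> (nat \<Rightarrow> 'a) \<Rightarrow> (nat \<Rightarrow> 'a) \<Rightarrow> nat \<Rightarrow> 'a" where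
  "series_mult A \<mu> p q k = (\<Oplus>\<^bsub>A\<^esub>i\<in>{..k}. \<mu> (p i) (q (k - i)))"

text \<open>The series \<open>a X^d\<close>.\<close>

definition series_monom :: "('r, 'a, 'p) module_scheme \<Rightarrow> nat \<Rightarrow> 'a \<Rightarrow> nat \<Rightarrow> 'a" where
  "series_monom A d a k = (if k = d then a else \<zero>\<^bsub>A\<^esub>)"

text \<open>Multiplication by X. It is an operator and not a product of two series, since
  \<open>A\<close> need not have a unit from which X could be formed.\<close>

definition series_shift :: "('r, 'a, 'p) module_scheme \<Rightarrow> (nat \<Rightarrow> 'a) \<Rightarrow> nat \<Rightarrow> 'a" where
  "series_shift A p k = (case k of 0 \<Rightarrow> \<zero>\<^bsub>A\<^esub> | Suc l \<Rightarrow> p l)"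

lemma series_module_simps [simp]:
  "carrier (series_module A) = UNIV \<rightarrow> carrier A"
  "\<zero>\<^bsub>series_module A\<^esub> = (\<lambda>k. \<zero>\<^bsub>A\<^esub>)"
  "p \<oplus>\<^bsub>series_module A\<^esub> q = (\<lambda>k. p k \<oplus>\<^bsub>A\<^esub> q k)"
  "c \<odot>\<^bsub>series_module A\<^esub> p = (\<lambda>k. c \<odot>\<^bsub>A\<^esub> p k)"
  by (simp_all add: series_module_def)

lemma (in module) series_module: "module R (series_module M)"
proof (rule moduleI)
  show "abelian_group (series_module M)"
  proof (rule abelian_groupI)
    fix p assume "p \<in> carrier (series_module M)"
    then show "\<exists>q\<in>carrier (series_module M).
        q \<oplus>\<^bsub>series_module M\<^esub> p = \<zero>\<^bsub>series_module M\<^esub>"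
      by (intro bexI[of _ "\<lambda>k. \<ominus>\<^bsub>M\<^esub> p k"]) (auto simp: Pi_iff M.l_neg)
  qed (auto simp: Pi_iff M.a_ac)
qed (auto simp: Pi_iff R.cring_axioms smult_l_distr smult_r_distr smult_assoc1 is_cring)

lemma (in module) linear_map_series_shift:
  "linear_map R (series_module M) (series_module M) (series_shift M)"
  by (auto simp: linear_map_def Pi_iff fun_eq_iff series_shift_def split: nat.splits)

context nonassoc_alg
begin

lemma series_mult_closed [simp, intro]:
  assumes "p \<in> UNIV \<rightarrow> carrier A" "q \<in> UNIV \<rightarrow> carrier A"
  shows "series_mult A \<mu> p q k \<in> carrier A"
  using assms by (auto simp: series_mult_def Pi_iff intro!: M.finsum_closed)

lemma nonassoc_alg_series:
  "nonassoc_alg R (series_module A) (series_mult A \<mu>)"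
  unfolding nonassoc_alg_iff nonassoc_algebra_def linear_map_def
  using series_module
  by (auto simp: fun_eq_iff series_mult_def Pi_iff mult_add mult_smult finsum_smult_ldistr
      simp flip: M.finsum_addf intro!: M.finsum_closed M.finsum_cong')

section \<open>Coefficients of Cauchy products\<close>

lemma series_mult_single:
  assumes "p \<in> UNIV \<rightarrow> carrier A" "q \<in> UNIV \<rightarrow> carrier A" "a \<le> k"
    and "\<And>i. \<lbrakk>i \<le> k; i \<noteq> a\<rbrakk> \<Longrightarrow> \<mu> (p i) (q (k - i)) = \<zero>\<^bsub>A\<^esub>"
  shows "series_mult A \<mu> p q k = \<mu> (p a) (q (k - a))"
proof -
  have "series_mult A \<mu> p q k = (\<Oplus>\<^bsub>A\<^esub>i\<in>{..k}. if i = a then \<mu> (p i) (q (k - i)) else \<zero>\<^bsub>A\<^esub>)"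
    unfolding series_mult_def using assms by (intro M.finsum_cong') (auto simp: Pi_iff)
  also have "\<dots> = \<mu> (p a) (q (k - a))"
    using assms by (intro M.add.finprod_singleton_swap) (auto simp: Pi_iff)
  finally show ?thesis .
qed

lemma series_mult_eq_zero:
  assumes "\<And>i. i \<le> k \<Longrightarrow> \<mu> (p i) (q (k - i)) = \<zero>\<^bsub>A\<^esub>"
  shows "series_mult A \<mu> p q k = \<zero>\<^bsub>A\<^esub>"
  using assms by (auto simp: series_mult_def intro!: M.add.finprod_one_eqI)

text \<open>X can be pulled out of either factor: shifting a factor only adds a summand that
  contains the constant coefficient zero of the shifted series.\<close>

lemma series_mult_shift:
  assumes "p \<in> UNIV \<rightarrow> carrier A" "q \<in> UNIV \<rightarrow> carrier A"
  shows "series_mult A \<mu> (series_shift A p) q = series_shift A (series_mult A \<mu> p q)"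
    and "series_mult A \<mu> p (series_shift A q) = series_shift A (series_mult A \<mu> p q)"
proof -
  have "series_mult A \<mu> (series_shift A p) q k = series_shift A (series_mult A \<mu> p q) k" for k
  proof (cases k)
    case (Suc l)
    \<comment> \<open>Index 0 is split off, where the shifted \<open>p\<close> vanishes; the
      remaining indices drop by one.\<close>
    have "series_mult A \<mu> (series_shift A p) q (Suc l) =
      (\<Oplus>\<^bsub>A\<^esub>i\<in>{..l}. \<mu> (p i) (q (l - i))) \<oplus>\<^bsub>A\<^esub> \<mu> \<zero>\<^bsub>A\<^esub> (q (Suc l))"
      using assms unfolding series_mult_def
      by (subst M.finsum_Suc2) (auto simp: series_shift_def Pi_iff split: nat.splits)
    then show ?thesis using assms Suc
      by (simp add: series_mult_def series_shift_def Pi_iff M.finsum_closed)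
  qed (use assms in \<open>simp add: series_mult_def series_shift_def Pi_iff\<close>)
  moreover have "series_mult A \<mu> p (series_shift A q) k = series_shift A (series_mult A \<mu> p q) k" for k
  proof (cases k)
    case (Suc l)
    \<comment> \<open>Here the top index is split off, because it meets coefficient 0 of the shifted
      \<open>q\<close>.\<close>
    have "series_mult A \<mu> p (series_shift A q) (Suc l) =
      \<mu> (p (Suc l)) \<zero>\<^bsub>A\<^esub> \<oplus>\<^bsub>A\<^esub> (\<Oplus>\<^bsub>A\<^esub>i\<in>{..l}. \<mu> (p i) (series_shift A q (Suc l - i)))"
      using assms unfolding series_mult_def
      by (subst M.finsum_Suc) (auto simp: series_shift_def Pi_iff split: nat.splits)
    also have "(\<Oplus>\<^bsub>A\<^esub>i\<in>{..l}. \<mu> (p i) (series_shift A q (Suc l - i))) =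
      (\<Oplus>\<^bsub>A\<^esub>i\<in>{..l}. \<mu> (p i) (q (l - i)))"
      using assms by (intro M.finsum_cong') (auto simp: series_shift_def Pi_iff Suc_diff_le)
    finally show ?thesis using assms Suc
      by (simp add: series_mult_def series_shift_def Pi_iff M.finsum_closed)
  qed (use assms in \<open>simp add: series_mult_def series_shift_def Pi_iff\<close>)
  ultimately show
    "series_mult A \<mu> (series_shift A p) q = series_shift A (series_mult A \<mu> p q)"
    "series_mult A \<mu> p (series_shift A q) = series_shift A (series_mult A \<mu> p q)"
    by blast+
qed

lemma series_mult_monom:
  assumes "a \<in> carrier A" "b \<in> carrier A"
  shows "series_mult A \<mu> (series_monom A d a) (series_monom A e b) = series_monom A (d + e) (\<mu> a b)"
proof
  fix k
  show "series_mult A \<mu> (series_monom A d a) (series_monom A e b) k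
    = series_monom A (d + e) (\<mu> a b) k"
  proof (cases "k = d + e")
    case True
    then show ?thesis using assms
      by (subst series_mult_single[where a = d]) (auto simp: series_monom_def)
  next
    case False
    \<comment> \<open>As i \<le> k, the subtraction \<open>k - i\<close> is not truncated; i = d and
      k - i = e would give k = d + e, so every summand has a zero factor.\<close>
    then show ?thesis using assms
      by (subst series_mult_eq_zero) (auto simp: series_monom_def)
  qed
qed

section \<open>Relations evaluated at monomial and two-term series\<close>

lemma eval_monomial_series_monom:
  assumes "\<And>i. x i \<in> carrier A"
  shows "eval_monomial (series_mult A \<mu>) (\<lambda>i. series_monom A (d i) (x i)) t =
    series_monom A (sum_list (map d (leaves t))) (eval_monomial \<mu> x t)"
  by (induction t) (simp_all add: series_mult_monom eval_monomial_closed[OF assms])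

text \<open>Degrees add along a monomial tree. Since every monomial of \<open>r\<close> uses each of
  the n variables once, all of them land in the same degree \<open>sum d {1..n}\<close> and can be
  combined there.\<close>

lemma eval_relation_series_monom:
  assumes "\<And>i. x i \<in> carrier A" "multilinear_relation R n r"
  shows "eval_relation (series_module A) (series_mult A \<mu>) (\<lambda>i. series_monom A (d i) (x i)) r =
    series_monom A (sum d {1..n}) (eval_relation A \<mu> x r)"
proof -
  interpret S: nonassoc_alg R "series_module A" "series_mult A \<mu>" by (rule nonassoc_alg_series)
  show ?thesis using assms(2)
  proof (induction r)
    case (Cons ct r)
    obtain c t where ct: "ct = (c, t)" by (cases ct)
    have "c \<in> carrier R" "multilinear_relation R n r"
      using Cons.prems by (auto simp: multilinear_relation_def ct)
    moreover have "sum_list (map d (leaves t)) = sum d {1..n}"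
      using Cons.prems by (auto simp: multilinear_relation_def multilinear_monomial_def ct
          sum_list_distinct_conv_sum_set)
    ultimately have "eval_relation (series_module A) (series_mult A \<mu>)
        (\<lambda>i. series_monom A (d i) (x i)) (ct # r) =
      c \<odot>\<^bsub>series_module A\<^esub> series_monom A (sum d {1..n}) (eval_monomial \<mu> x t) \<oplus>\<^bsub>series_module A\<^esub>
        series_monom A (sum d {1..n}) (eval_relation A \<mu> x r)"
      using Cons.IH
      by (simp add: ct S.eval_relation_simps eval_monomial_series_monom[OF assms(1)])
    also have "\<dots> = series_monom A (sum d {1..n}) (eval_relation A \<mu> x (ct # r))"
      using \<open>c \<in> carrier R\<close> by (auto simp: ct eval_relation_simps series_monom_def fun_eq_iff)
    finally show ?case .
  qed (simp add: eval_relation_simps S.eval_relation_simps series_monom_def fun_eq_iff)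
qed

text \<open>Multilinearity reduces arguments that are sums of two monomials to arguments that are
  monomials, for which the value is a monomial with coefficient an evaluation in \<open>A\<close>.\<close>

lemma eval_relation_series_two_terms:
  assumes "multilinear_relation R n r"
    and "\<And>x. x \<in> UNIV \<rightarrow> carrier A \<Longrightarrow> eval_relation A \<mu> x r = \<zero>\<^bsub>A\<^esub>"
    and "\<And>i. a i \<in> carrier A" "\<And>i. b i \<in> carrier A"
  shows "eval_relation (series_module A) (series_mult A \<mu>)
    (\<lambda>i. series_monom A (d i) (a i) \<oplus>\<^bsub>series_module A\<^esub> series_monom A (e i) (b i)) r =
    \<zero>\<^bsub>series_module A\<^esub>"
proof -
  interpret S: nonassoc_alg R "series_module A" "series_mult A \<mu>" by (rule nonassoc_alg_series)
  let ?E = "\<lambda>x. eval_relation (series_module A) (series_mult A \<mu>) x r"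
  let ?y = "\<lambda>i. series_monom A (d i) (a i) \<oplus>\<^bsub>series_module A\<^esub> series_monom A (e i) (b i)"
  have mono: "series_monom A k u \<in> carrier (series_module A)" if "u \<in> carrier A" for k u
    using that by (auto simp: series_monom_def)
  \<comment> \<open>Induction on the set \<open>V\<close> of variables that carry two terms. The
    monomials at the other variables stay arbitrary, since splitting a variable changes its degree
    and coefficient.\<close>
  have "?E (\<lambda>i. if i \<in> V then ?y i else series_monom A (f i) (c i)) = \<zero>\<^bsub>series_module A\<^esub>"
    if "finite V" "V \<subseteq> {1..n}" "\<And>i. c i \<in> carrier A" for V f c
    using that
  proof (induction V arbitrary: f c)
    case empty
    then have "?E (\<lambda>i. series_monom A (f i) (c i)) = series_monom A (sum f {1..n}) \<zero>\<^bsub>A\<^esub>"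
      by (simp add: eval_relation_series_monom[OF _ assms(1)] assms(2))
    also have "series_monom A (sum f {1..n}) \<zero>\<^bsub>A\<^esub> = \<zero>\<^bsub>series_module A\<^esub>"
      by (simp add: series_monom_def fun_eq_iff)
    finally show ?case by (simp del: series_module_simps)
  next
    case (insert v V)
    let ?z = "\<lambda>i. if i \<in> V then ?y i else series_monom A (f i) (c i)"
    have z: "?z j \<in> carrier (series_module A)" for j
      using insert.prems mono assms(3,4) S.M.add.m_closed by (auto simp del: series_module_simps)
    \<comment> \<open>Each half of the split at \<open>v\<close> is again a family covered by the
      induction hypothesis, with \<open>f\<close> and \<open>c\<close> changed at \<open>v\<close>
      only.\<close>
    have upd: "?z(v := series_monom A k u) =
      (\<lambda>i. if i \<in> V then ?y i else series_monom A ((f(v := k)) i) ((c(v := u)) i))" for k u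
      using insert.hyps by (auto simp: fun_eq_iff)
    have "(\<lambda>i. if i \<in> insert v V then ?y i else series_monom A (f i) (c i)) = ?z(v := ?y v)"
      by auto
    then have "?E (\<lambda>i. if i \<in> insert v V then ?y i else series_monom A (f i) (c i)) =
      ?E (?z(v := series_monom A (d v) (a v))) \<oplus>\<^bsub>series_module A\<^esub>
      ?E (?z(v := series_monom A (e v) (b v)))"
      using S.eval_relation_add[OF z mono mono assms(1)] assms(3,4) insert.prems
      by (auto simp del: series_module_simps)
    also have "\<dots> = \<zero>\<^bsub>series_module A\<^esub> \<oplus>\<^bsub>series_module A\<^esub> \<zero>\<^bsub>series_module A\<^esub>"
      unfolding upd using insert.prems assms(3,4)
      by (subst (1 2) insert.IH) auto
    finally show ?case by (simp only: S.M.l_zero S.M.zero_closed)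
  qed
  \<comment> \<open>Outside 1 to n the monomials given by \<open>a\<close> and \<open>d\<close> are
    placeholders; \<open>eval_relation_cong\<close> replaces them by \<open>?y\<close>.\<close>
  from this[of "{1..n}" a d]
  have "?E (\<lambda>i. if i \<in> {1..n} then ?y i else series_monom A (d i) (a i)) = \<zero>\<^bsub>series_module A\<^esub>"
    using assms(3) by simp
  moreover have "?E (\<lambda>i. if i \<in> {1..n} then ?y i else series_monom A (d i) (a i)) = ?E ?y"
    by (rule eval_relation_cong[OF assms(1)]) simp
  ultimately show ?thesis by simp
qed


section \<open>Linear maps applied coefficientwise\<close>

lemma linear_map_finsum:
  assumes "linear_map R A A f" "finite I" "g \<in> I \<rightarrow> carrier A"
  shows "f (\<Oplus>\<^bsub>A\<^esub>i\<in>I. g i) = (\<Oplus>\<^bsub>A\<^esub>i\<in>I. f (g i))"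
  using assms(2,3)
proof (induction I)
  case empty
  show ?case
    using linear_map_zero[OF module_axioms module_axioms assms(1)] by simp
next
  case (insert i I)
  then have "g i \<in> carrier A" "g \<in> I \<rightarrow> carrier A" by auto
  with insert show ?case
    using linear_mapD[OF assms(1)] by (simp add: Pi_iff M.finsum_closed)
qed

lemma series_mult_comp:
  assumes "linear_map R A A f" "p \<in> UNIV \<rightarrow> carrier A" "q \<in> UNIV \<rightarrow> carrier A"
  shows "f \<circ> series_mult A \<mu> p q = series_mult A (\<lambda>a b. f (\<mu> a b)) p q"
  using assms(2,3)
  by (auto simp: fun_eq_iff series_mult_def Pi_iff intro!: linear_map_finsum[OF assms(1)])

end

section \<open>The deformed product\<close>

locale nijenhuis_alg = nonassoc_alg R A \<mu>
  for R :: "('r, 'm) ring_scheme" and A :: "('r, 'a, 'p) module_scheme"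
    and \<mu> :: "'a \<Rightarrow> 'a \<Rightarrow> 'a" +
  fixes N :: "'a \<Rightarrow> 'a"
  assumes nijenhuis: "nijenhuis_operator R A \<mu> N"
begin

abbreviation star where "star \<equiv> nijenhuis_product A \<mu> N"
abbreviation S where "S \<equiv> series_module A"
abbreviation X where "X \<equiv> series_shift A"
abbreviation C where "C \<equiv> series_mult A \<mu>"

definition deformed_mult where
  "deformed_mult p q = C p q \<oplus>\<^bsub>S\<^esub> X (series_mult A star p q)"

text \<open>In deformation theory a deformation is trivial if a map of the form
  \<open>id + X N + ...\<close> carries it to the undeformed product; hence the name.\<close>

definition trivialization where
  "trivialization p = p \<oplus>\<^bsub>S\<^esub> X (N \<circ> p)"

lemma linear_map_N: "linear_map R A A N"
  using nijenhuis by (simp add: nijenhuis_operator_def)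

lemmas N_simps [simp] = linear_mapD[OF linear_map_N]
  linear_map_zero[OF module_axioms module_axioms linear_map_N]
  linear_map_a_inv[OF module_axioms module_axioms linear_map_N]

lemma nonassoc_alg_star: "nonassoc_alg R A star"
  unfolding nonassoc_alg_iff nonassoc_algebra_def linear_map_def
  using module_axioms
  by (auto simp: nijenhuis_product_def a_minus_def mult_add mult_smult smult_r_distr
      smult_r_minus M.minus_add M.a_ac)

sublocale star: nonassoc_alg R A star
  by (rule nonassoc_alg_star)

sublocale S: nonassoc_alg R S C
  by (rule nonassoc_alg_series)

text \<open>The Nijenhuis identity itself. It is the coefficient of \<open>X^2\<close> in the
  homomorphism property of \<open>trivialization\<close> on constants.\<close>

lemma mult_N_N:
  "\<lbrakk>a \<in> carrier A; b \<in> carrier A\<rbrakk> \<Longrightarrow> \<mu> (N a) (N b) = N (star a b)"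
  using nijenhuis by (simp add: nijenhuis_operator_def nijenhuis_product_def)

text \<open>The coefficient of X in the same property; it only rearranges the definition of
  \<open>star\<close>.\<close>

lemma N_mult_star:
  assumes "a \<in> carrier A" "b \<in> carrier A"
  shows "N (\<mu> a b) \<oplus>\<^bsub>A\<^esub> star a b = \<mu> (N a) b \<oplus>\<^bsub>A\<^esub> \<mu> a (N b)"
proof -
  have *: "u \<oplus>\<^bsub>A\<^esub> (v \<oplus>\<^bsub>A\<^esub> \<ominus>\<^bsub>A\<^esub> u) = v" if "u \<in> carrier A" "v \<in> carrier A" for u v
    using that by (metis M.a_comm M.a_inv_closed M.a_lcomm M.r_neg M.r_zero)
  show ?thesis
    unfolding nijenhuis_product_def a_minus_def using assms by (intro *) auto
qed

lemma series_mult_N_N: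
  assumes "p \<in> carrier S" "q \<in> carrier S"
  shows "C (N \<circ> p) (N \<circ> q) = N \<circ> series_mult A star p q"
proof -
  have "C (N \<circ> p) (N \<circ> q) = series_mult A (\<lambda>a b. N (star a b)) p q"
    using assms by (auto simp: fun_eq_iff series_mult_def Pi_iff mult_N_N intro!: M.finsum_cong')
  then show ?thesis
    using star.series_mult_comp[OF linear_map_N] assms by simp
qed

lemma series_N_mult_star:
  assumes "p \<in> carrier S" "q \<in> carrier S"
  shows "(N \<circ> C p q) \<oplus>\<^bsub>S\<^esub> series_mult A star p q = C (N \<circ> p) q \<oplus>\<^bsub>S\<^esub> C p (N \<circ> q)"
  using assms
  by (auto simp: fun_eq_iff Pi_iff series_mult_comp[OF linear_map_N] series_mult_def N_mult_star
      linear_map_finsum[OF linear_map_N]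
      simp flip: M.finsum_addf intro!: M.finsum_cong')

lemmas X_simps = linear_mapD[OF linear_map_series_shift]

lemma N_comp_simps:
  shows "p \<in> carrier S \<Longrightarrow> N \<circ> p \<in> carrier S"
    and "\<lbrakk>p \<in> carrier S; q \<in> carrier S\<rbrakk> \<Longrightarrow> N \<circ> (p \<oplus>\<^bsub>S\<^esub> q) = (N \<circ> p) \<oplus>\<^bsub>S\<^esub> (N \<circ> q)"
    and "N \<circ> X p = X (N \<circ> p)"
  by (auto simp: fun_eq_iff Pi_iff series_shift_def split: nat.splits)

lemma series_star_closed:
  "\<lbrakk>p \<in> carrier S; q \<in> carrier S\<rbrakk> \<Longrightarrow> series_mult A star p q \<in> carrier S"
  by auto

lemma deformed_mult_Suc:
  "deformed_mult p q (Suc k) = C p q (Suc k) \<oplus>\<^bsub>A\<^esub> series_mult A star p q k"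
  by (simp add: deformed_mult_def series_shift_def)

lemma deformed_mult_closed:
  "\<lbrakk>p \<in> carrier S; q \<in> carrier S\<rbrakk> \<Longrightarrow> deformed_mult p q \<in> carrier S"
  unfolding deformed_mult_def
  by (intro S.M.add.m_closed S.mult_closed X_simps series_star_closed)

lemma nonassoc_alg_deformed: "nonassoc_alg R S deformed_mult"
proof -
  interpret T: nonassoc_alg R S "series_mult A star" by (rule star.nonassoc_alg_series)
  show ?thesis
    unfolding nonassoc_alg_iff nonassoc_algebra_def linear_map_def
    using S.module_axioms deformed_mult_closed
    by (auto simp: deformed_mult_def S.mult_add S.mult_smult T.mult_add T.mult_smult X_simps
        S.smult_r_distr S.M.a_ac simp del: series_module_simps)
qed

lemma linear_map_trivialization: "linear_map R S S trivialization"
  by (auto simp: linear_map_def trivialization_def fun_eq_iff Pi_iff series_shift_def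
      smult_r_distr M.a_ac split: nat.splits)

text \<open>Both sides are expanded into powers of X and compared: the constant parts agree, and the
  other two match by \<open>series_N_mult_star\<close> and \<open>series_mult_N_N\<close>.\<close>

lemma trivialization_deformed_mult:
  assumes p: "p \<in> carrier S" and q: "q \<in> carrier S"
  shows "trivialization (deformed_mult p q) = C (trivialization p) (trivialization q)"
proof -
  let ?s = "series_mult A star p q"
  note closed = p q series_star_closed[OF p q] N_comp_simps(1) X_simps(1) S.mult_closed
  note shift = series_mult_shift[folded series_module_simps(1)[of A]]
  have "trivialization (deformed_mult p q) =
    C p q \<oplus>\<^bsub>S\<^esub> X ((N \<circ> C p q) \<oplus>\<^bsub>S\<^esub> ?s) \<oplus>\<^bsub>S\<^esub> X (X (N \<circ> ?s))"
    unfolding trivialization_def deformed_mult_def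
    by (simp add: closed N_comp_simps X_simps S.M.a_ac del: series_module_simps)
  also have "\<dots> = C p q \<oplus>\<^bsub>S\<^esub> X (C (N \<circ> p) q \<oplus>\<^bsub>S\<^esub> C p (N \<circ> q)) \<oplus>\<^bsub>S\<^esub> X (X (C (N \<circ> p) (N \<circ> q)))"
    by (simp only: series_N_mult_star series_mult_N_N p q)
  \<comment> \<open>Bilinearity expands the right-hand side into four products, and X is pulled out
    of each shifted factor.\<close>
  also have "\<dots> = C (trivialization p) (trivialization q)"
    unfolding trivialization_def
    by (simp add: closed X_simps S.mult_add shift S.M.a_ac del: series_module_simps)
  finally show ?thesis .
qed

text \<open>Coefficient k + 1 of the image is \<open>p (Suc k)\<close> plus \<open>N (p k)\<close>,
  and coefficient 0 is \<open>p 0\<close>, so the coefficients of \<open>p\<close> vanish one after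
  another.\<close>

lemma trivialization_eq_zero:
  assumes "p \<in> carrier S" "trivialization p = \<zero>\<^bsub>S\<^esub>"
  shows "p = \<zero>\<^bsub>S\<^esub>"
proof -
  have *: "p k \<oplus>\<^bsub>A\<^esub> X (N \<circ> p) k = \<zero>\<^bsub>A\<^esub>" for k
    using fun_cong[OF assms(2), of k] by (simp add: trivialization_def)
  have closed: "p k \<in> carrier A" for k using assms(1) by auto
  have "p k = \<zero>\<^bsub>A\<^esub>" for k
  proof (induction k)
    case 0
    show ?case using *[of 0] closed by (simp add: series_shift_def)
  next
    case (Suc k)
    then show ?case using *[of "Suc k"] closed by (simp add: series_shift_def)
  qed
  then show ?thesis by auto
qed

text \<open>A tree with m leaves has m - 1 products, and each contributes at most one X, through its
  \<open>star\<close> part. Degree m - 1 is reached only by taking \<open>star\<close> at every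
  node. The two claims are proved together because the top coefficient of a product is isolated by
  the vanishing of higher ones.\<close>

lemma eval_monomial_deformed:
  assumes "\<And>i. x i \<in> carrier A"
  shows "length (leaves t) \<le> k \<Longrightarrow>
      eval_monomial deformed_mult (\<lambda>i. series_monom A 0 (x i)) t k = \<zero>\<^bsub>A\<^esub>"
    and "eval_monomial deformed_mult (\<lambda>i. series_monom A 0 (x i)) t (length (leaves t) - 1) =
      eval_monomial star x t"
proof (induction t arbitrary: k)
  case (Var i)
  { case 1 then show ?case by (auto simp: series_monom_def) }
  { case 2 then show ?case by (auto simp: series_monom_def) }
next
  case (Mul s t)
  interpret D: nonassoc_alg R S deformed_mult by (rule nonassoc_alg_deformed)
  let ?e = "eval_monomial deformed_mult (\<lambda>i. series_monom A 0 (x i))"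
  have e: "?e u \<in> UNIV \<rightarrow> carrier A" for u
    using D.eval_monomial_closed[of "\<lambda>i. series_monom A 0 (x i)" u] assms
    by (auto simp: series_monom_def)
  have e': "?e u i \<in> carrier A" for u i using e[of u] by auto
  have pos: "length (leaves u) > 0" for u by (induction u) auto
  \<comment> \<open>The factors have degrees below their leaf counts, so their product vanishes from
    the sum of the counts minus 1 on. This sharp bound is needed for the shifted \<open>star\<close>
    part in case 1 and for the \<open>\<mu>\<close> part in case 2.\<close>
  have vanish: "series_mult A \<nu> (?e s) (?e t) k = \<zero>\<^bsub>A\<^esub>"
    if "nonassoc_alg R A \<nu>" "Suc k \<ge> length (leaves s) + length (leaves t)" for \<nu> k
  proof -
    interpret V: nonassoc_alg R A \<nu> by fact
    have "\<nu> (?e s i) (?e t (k - i)) = \<zero>\<^bsub>A\<^esub>" if "i \<le> k" for i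
    proof (cases "length (leaves s) \<le> i")
      case True
      then show ?thesis using Mul.IH(1) e' by simp
    next
      case False
      then have "length (leaves t) \<le> k - i" using that \<open>Suc k \<ge> _\<close> by linarith
      then show ?thesis using Mul.IH(3) e' by simp
    qed
    then show ?thesis by (rule V.series_mult_eq_zero)
  qed
  { case 1
    with pos[of s] pos[of t] obtain l where l: "k = Suc l" "Suc l \<ge> length (leaves s) + length (leaves t)"
      by (cases k) auto
    then show ?case
      using vanish[OF nonassoc_alg_axioms, of k] vanish[OF nonassoc_alg_star, of l]
      by (simp add: deformed_mult_Suc) }
  { case 2
    obtain a b where ab: "length (leaves s) = Suc a" "length (leaves t) = Suc b"
      using pos[of s] pos[of t] by (metis gr0_conv_Suc)
    \<comment> \<open>The factors have degrees at most \<open>a\<close> and \<open>b\<close>, so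
      only the two top coefficients meet in degree \<open>a + b\<close>.\<close>
    have "star (?e s i) (?e t (a + b - i)) = \<zero>\<^bsub>A\<^esub>" if "i \<le> a + b" "i \<noteq> a" for i
    proof (cases "a < i")
      case True
      then show ?thesis using Mul.IH(1)[of i] e' ab by simp
    next
      case False
      then show ?thesis using that Mul.IH(3)[of "a + b - i"] e' ab by simp
    qed
    then have "series_mult A star (?e s) (?e t) (a + b) = star (?e s a) (?e t b)"
      by (subst star.series_mult_single[OF e e, of a]) auto
    moreover have "?e s a = eval_monomial star x s" "?e t b = eval_monomial star x t"
      using Mul.IH(2,4) ab by auto
    moreover have "C (?e s) (?e t) (Suc (a + b)) = \<zero>\<^bsub>A\<^esub>"
      using ab by (intro vanish nonassoc_alg_axioms) simp
    moreover have "star (eval_monomial star x s) (eval_monomial star x t) \<in> carrier A"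
      using assms by (intro star.mult_closed star.eval_monomial_closed)
    moreover have "length (leaves (Mul s t)) - 1 = Suc (a + b)"
      using ab by simp
    ultimately show ?case
      by (simp only: eval_monomial.simps deformed_mult_Suc M.l_zero) }
qed

lemma eval_relation_star:
  assumes r: "multilinear_relation R n r"
    and zero: "\<And>x. x \<in> UNIV \<rightarrow> carrier A \<Longrightarrow> eval_relation A \<mu> x r = \<zero>\<^bsub>A\<^esub>"
    and x: "x \<in> UNIV \<rightarrow> carrier A"
  shows "eval_relation A star x r = \<zero>\<^bsub>A\<^esub>"
proof -
  interpret D: nonassoc_alg R S deformed_mult by (rule nonassoc_alg_deformed)
  let ?x = "\<lambda>i. series_monom A 0 (x i)"
  have x': "x i \<in> carrier A" "?x i \<in> carrier S" for i
    using x by (auto simp: series_monom_def)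
  have coeffs: "fst ` set r \<subseteq> carrier R"
    using r by (auto simp: multilinear_relation_def)
  \<comment> \<open>The image of a constant series under \<open>trivialization\<close> has just two
    terms, in degrees 0 and 1, as \<open>eval_relation_series_two_terms\<close> demands.\<close>
  have "X (N \<circ> series_monom A 0 a) = series_monom A 1 (N a)" for a
    by (auto simp: fun_eq_iff series_shift_def series_monom_def split: nat.splits)
  then have "trivialization \<circ> ?x =
    (\<lambda>i. series_monom A 0 (x i) \<oplus>\<^bsub>S\<^esub> series_monom A 1 (N (x i)))"
    by (simp add: trivialization_def comp_def)
  moreover have "trivialization (eval_relation S deformed_mult ?x r) =
    eval_relation S C (trivialization \<circ> ?x) r"
    using D.hom_eval_relation[where f = trivialization and B = S and \<nu> = C and x = ?x and r = r,
        OF S.nonassoc_alg_axioms linear_map_trivialization trivialization_deformed_mult x'(2) coeffs] .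
  moreover have "eval_relation S C
    (\<lambda>i. series_monom A 0 (x i) \<oplus>\<^bsub>S\<^esub> series_monom A 1 (N (x i))) r = \<zero>\<^bsub>S\<^esub>"
    using x' by (intro eval_relation_series_two_terms[OF r zero]) simp_all
  ultimately have "trivialization (eval_relation S deformed_mult ?x r) = \<zero>\<^bsub>S\<^esub>"
    by (simp only:)
  then have "eval_relation S deformed_mult ?x r = \<zero>\<^bsub>S\<^esub>"
    by (rule trivialization_eq_zero[OF D.eval_relation_closed[OF x'(2) coeffs]])
  \<comment> \<open>Every monomial of \<open>r\<close> has n leaves, so one index reads off all top
    coefficients. If n = 0, then \<open>r\<close> is empty, because each monomial has a leaf, and
    the truncated \<open>n - 1\<close> is harmless.\<close>
  moreover have "eval_relation S deformed_mult ?x r (n - 1) = eval_relation A star x r"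
    using r
  proof (induction r)
    case Nil
    show ?case by (simp add: D.eval_relation_simps star.eval_relation_simps)
  next
    case (Cons ct r)
    obtain c t where ct: "ct = (c, t)" by (cases ct)
    have "length (leaves t) = n" and r: "multilinear_relation R n r"
      using Cons.prems distinct_card[of "leaves t"]
      by (auto simp: multilinear_relation_def multilinear_monomial_def ct)
    then show ?case
      using Cons.IH[OF r] eval_monomial_deformed(2)[of x t, OF x'(1)]
      by (simp add: D.eval_relation_simps star.eval_relation_simps ct)
  qed
  ultimately show ?thesis by simp
qed

end

theorem theorem4p4:
  fixes R :: "('r, 'm) ring_scheme"
    and A :: "('r, 'a, 'p) module_scheme"
    and rels :: "('r \<times> monomial) list list"
    and \<mu> :: "'a \<Rightarrow> 'a \<Rightarrow> 'a"
    and N :: "'a \<Rightarrow> 'a"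
  assumes "cring R"
    and "\<forall>r\<in>set rels. \<exists>n. multilinear_relation R n r"
    and "in_category R rels A \<mu>"
    and "nijenhuis_operator R A \<mu> N"
  shows "in_category R rels A (nijenhuis_product A \<mu> N)"
proof -
  interpret nijenhuis_alg R A \<mu> N
    using assms(3,4)
    by (simp add: nijenhuis_alg_def nijenhuis_alg_axioms_def nonassoc_alg_iff in_category_def)
  show ?thesis
    unfolding in_category_def
  proof (intro conjI ballI)
    show "nonassoc_algebra R A star"
      using nonassoc_alg_star by (simp add: nonassoc_alg_iff)
  next
    fix r and x :: "nat \<Rightarrow> 'a"
    assume "r \<in> set rels" "x \<in> UNIV \<rightarrow> carrier A"
    \<comment> \<open>Each relation is treated separately, with its own number of variables.\<close>
    then show "eval_relation A star x r = \<zero>\<^bsub>A\<^esub>"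
      using assms(2,3) eval_relation_star by (auto simp: in_category_def)
  qed
qed

end
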